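(* Let $k>0$, let $v_L=(u_L,\sigma_L)$ and $v_R=(u_R,\sigma_R)$ in $\mathbb{R}^2$ be given states with $u_L\neq u_R$, and let $\phi=(\phi_1,\phi_2)$ be a DLM path. Let $A(u,\sigma)=\begin{pmatrix} u & -1\\ -k^2 & u\end{pmatrix}$ be the coefficient matrix of the system $u_t+uu_x-\sigma_x=0,\ \sigma_t+u\sigma_x-k^2u_x=0$, and put $$s=\frac{[\frac{u^2}{2}]-[\sigma]}{[u]}.$$ If $$\int_0^1 \phi_1(t;u_L,u_R)\,(\phi_2)_t(t;\sigma_L,\sigma_R)\,dt=[\sigma]\cdot\frac{[\frac{u^2}{2}]-[\sigma]}{[u]}+k^2[u],$$ then the Rankine-Hugoniot condition $$\int_0^1\{-s\,\mathrm{Id}+A(\phi(t;v_L,v_R))\}\,\phi_t(t;v_L,v_R)\,dt=0$$ is satisfied, with $s$ as the speed of the shock.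
   Context: Jumps: $[u]=u_R-u_L$, $[\sigma]=\sigma_R-\sigma_L$, $[\frac{u^2}{2}]=\frac{u_R^2}{2}-\frac{u_L^2}{2}$. $\mathrm{Id}$ is the $2\times 2$ identity matrix, and the subscript $t$ on a path denotes the derivative in its first argument $t$ (existing for almost every $t$). A DLM path is a locally Lipschitz map $\phi:[0,1]\times\mathbb{R}^2\times\mathbb{R}^2\to\mathbb{R}^2$ such that: (1) $\phi(0;v_L,v_R)=v_L$ and $\phi(1;v_L,v_R)=v_R$ for all $v_L,v_R\in\mathbb{R}^2$; (2) $\phi(t;v,v)=v$ for all $v\in\mathbb{R}^2$, $t\in[0,1]$; (3) for every bounded set $\Omega\subset\mathbb{R}^2$ there is a constant $K\ge 1$ such that $|\phi_t(t;v_L,v_R)-\phi_t(t;w_L,w_R)|\le K\,|(v_L-w_L)-(v_R-w_R)|$ for all $v_L,v_R,w_L,w_R\in\Omega$ and almost every $t\in[0,1]$. The components of the path $\phi(t;v_L,v_R)$ connecting $v_L=(u_L,\sigma_L)$ to $v_R=(u_R,\sigma_R)$ are written $\phi_1(t;u_L,u_R)$ (the $u$-component) and $\phi_2(t;\sigma_L,\sigma_R)$ (the $\sigma$-component). *)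

theory Defs
  imports "HOL-Analysis.Analysis"
begin

definition locally_lipschitz_on :: "'a::metric_space set \<Rightarrow> ('a \<Rightarrow> 'b::metric_space) \<Rightarrow> bool" where
  "locally_lipschitz_on X f \<longleftrightarrow> (\<forall>x\<in>X. \<exists>r>0. \<exists>L. L-lipschitz_on (ball x r \<inter> X) f)"

text \<open>A path family is a total function of type \<open>real \<Rightarrow> real^2 \<Rightarrow> real^2 \<Rightarrow> real^2\<close>; only its values for
  \<open>t\<close> in \<open>{0..1}\<close> matter. The \<open>t\<close>-derivative is therefore taken within \<open>{0..1}\<close>. For a locally
  Lipschitz family it exists for almost every \<open>t\<close>; at the remaining \<open>t\<close> its value is unspecified.\<close>

definition t_deriv :: "(real \<Rightarrow> 'a::real_normed_vector) \<Rightarrow> real \<Rightarrow> 'a" where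
  "t_deriv p t = vector_derivative p (at t within {0..1})"

definition DLM_path :: "(real \<Rightarrow> real^2 \<Rightarrow> real^2 \<Rightarrow> real^2) \<Rightarrow> bool" where
  "DLM_path \<phi> \<longleftrightarrow>
     locally_lipschitz_on ({0..1} \<times> UNIV \<times> UNIV) (\<lambda>(t, vL, vR). \<phi> t vL vR) \<and>
     (\<forall>vL vR. \<phi> 0 vL vR = vL \<and> \<phi> 1 vL vR = vR) \<and>
     (\<forall>v. \<forall>t\<in>{0..1}. \<phi> t v v = v) \<and>
     (\<forall>\<Omega>. bounded \<Omega> \<longrightarrow> (\<exists>K\<ge>1. \<forall>vL\<in>\<Omega>. \<forall>vR\<in>\<Omega>. \<forall>wL\<in>\<Omega>. \<forall>wR\<in>\<Omega>.
        AE t in lebesgue_on {0..1}.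
          norm (t_deriv (\<lambda>t. \<phi> t vL vR) t - t_deriv (\<lambda>t. \<phi> t wL wR) t)
            \<le> K * norm ((vL - wL) - (vR - wR))))"

text \<open>Coefficient matrix of \<open>u\<^sub>t + u u\<^sub>x - \<sigma>\<^sub>x = 0\<close>, \<open>\<sigma>\<^sub>t + u \<sigma>\<^sub>x - k\<^sup>2 u\<^sub>x = 0\<close> at the state
  \<open>v = (u, \<sigma>)\<close>, given by rows.\<close>

definition coeff_matrix :: "real \<Rightarrow> real^2 \<Rightarrow> real^2^2" where
  "coeff_matrix k v = vector [vector [v $ 1, - 1], vector [- (k\<^sup>2), v $ 1]]"

text \<open>Using \<open>has_integral\<close> rather than an equation for \<open>integral\<close> makes the condition include
  integrability, so that it cannot hold by the default value of a non-existent integral.\<close>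

definition rankine_hugoniot ::
  "(real^2 \<Rightarrow> real^2^2) \<Rightarrow> (real \<Rightarrow> real^2 \<Rightarrow> real^2 \<Rightarrow> real^2) \<Rightarrow> real \<Rightarrow> real^2 \<Rightarrow> real^2 \<Rightarrow> bool" where
  "rankine_hugoniot A \<phi> s vL vR \<longleftrightarrow>
     ((\<lambda>t. (- (s *\<^sub>R mat 1) + A (\<phi> t vL vR)) *v t_deriv (\<lambda>t. \<phi> t vL vR) t) has_integral 0) {0..1}"

end

theory Submission
  imports Defs
begin

text \<open>
  Write \<open>p = (u, \<sigma>)\<close> for the curve \<open>t \<mapsto> \<phi> t vL vR\<close>. The two components of
  \<open>(- s Id + A (p t)) p' t\<close> are \<open>u u' - s u' - \<sigma>'\<close> and \<open>u \<sigma>' - s \<sigma>' - k\<^sup>2 u'\<close>. The first is the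
  derivative of \<open>u\<^sup>2 / 2 - s u - \<sigma>\<close>, so its integral is \<open>[u\<^sup>2 / 2] - s [u] - [\<sigma>]\<close>, and this
  vanishes by the choice of \<open>s\<close>: for a conservative equation the path does not matter.
  In the second component only \<open>u \<sigma>'\<close> is not the derivative of a function of the state,
  and the hypothesis prescribes exactly the value of its integral, namely \<open>s [\<sigma>] + k\<^sup>2 [u]\<close>,
  that cancels the remaining terms.

  The analytic content is that \<open>p\<close> is merely Lipschitz. Hence everything rests on
  the fundamental theorem of calculus for Lipschitz curves (\<open>Lipschitz_fundamental_theorem\<close>): such
  a curve is differentiable almost everywhere, its derivative is absolutely integrable, and the
  integral of the derivative is the increment. Absolute integrability is what makes \<open>u \<sigma>'\<close>
  integrable, so that the hypothesis on its integral is a statement about an integral that exists.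

  The fundamental theorem is obtained by finding the density first and the derivative afterwards.
  After adding a linear term, a real Lipschitz function becomes a bi-Lipschitz bijection \<open>F\<close> of the
  line. The measure that gives an interval \<open>{a..b}\<close> the mass \<open>F b - F a\<close> is absolutely continuous,
  because Lipschitz maps send null sets to null sets; its Radon-Nikodym density integrates
  to the increments of \<open>F\<close> (\<open>expanding_Lipschitz_has_density\<close>). Lebesgue's differentiation theorem
  then says that the density is the derivative almost everywhere (\<open>derivative_of_primitive\<close>).
\<close>

section \<open>Lipschitz functions on the line are indefinite integrals\<close>

text \<open>
  The Radon-Nikodym theorem is applied to the image \<open>M\<close> of Lebesgue measure under the inverse of
  \<open>F\<close>. The lower bound on the slope makes \<open>F\<close> a bijection with a continuous inverse, so that
  \<open>M A\<close> is the Lebesgue measure of \<open>F ` A\<close>; the upper bound makes \<open>M\<close> absolutely continuous.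
\<close>

lemma expanding_Lipschitz_has_density:
  fixes F :: "real \<Rightarrow> real"
  assumes expand: "\<And>x y. x \<le> y \<Longrightarrow> y - x \<le> F y - F x"
    and lips: "\<And>x y. x \<le> y \<Longrightarrow> F y - F x \<le> C * (y - x)"
  obtains h where "\<And>a b. a \<le> b \<Longrightarrow> (h has_integral F b - F a) {a..b}"
proof -
  have Flip: "\<bar>F x - F y\<bar> \<le> C * \<bar>x - y\<bar>" for x y
    using lips[of x y] lips[of y x] expand[of x y] expand[of y x] by (cases "x \<le> y") auto
  have "0 \<le> C"
    using expand[of 0 1] lips[of 0 1] by auto
  then have "C-lipschitz_on UNIV F"
    using Flip by (intro lipschitz_onI) (auto simp: dist_real_def)
  then have contF: "continuous_on UNIV F"
    by (rule lipschitz_on_continuous_on)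
  have mono: "F x \<le> F y \<longleftrightarrow> x \<le> y" for x y
    using expand[of x y] expand[of y x] by (cases "x \<le> y") auto
  have inj: "inj F"
    by (rule injI) (metis mono order_antisym order_refl)
  have surj: "\<exists>x. F x = y" for y
  proof -
    define r where "r = \<bar>y - F 0\<bar>"
    have "F (- r) \<le> y" "y \<le> F r"
      using expand[of "- r" 0] expand[of 0 r] unfolding r_def by auto
    moreover have "continuous_on {- r..r} F"
      using contF continuous_on_subset by blast
    ultimately show ?thesis
      using IVT'[of F "- r" y r] unfolding r_def by auto
  qed
  define g where "g = inv F"
  have Fg: "F (g y) = y" for y
    unfolding g_def using surj by (metis f_inv_into_f rangeI)
  have gF: "g (F x) = x" for x
    unfolding g_def using inj by simp
  have "\<bar>g x - g y\<bar> \<le> \<bar>x - y\<bar>" for x y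
    using expand[of "g x" "g y"] expand[of "g y" "g x"] by (cases "g x \<le> g y") (auto simp: Fg)
  then have "1-lipschitz_on UNIV g"
    by (intro lipschitz_onI) (auto simp: dist_real_def)
  then have [measurable]: "g \<in> borel_measurable borel"
    by (intro borel_measurable_continuous_onI lipschitz_on_continuous_on)
  define M where "M = distr lborel borel g"
  have vimage: "g -` A = F ` A" for A
    by (auto simp: image_iff gF) (metis Fg)
  have "absolutely_continuous lborel M"
    unfolding absolutely_continuous_def
  proof
    fix A :: "real set" assume A: "A \<in> null_sets lborel"
    then have "negligible A"
      by (simp add: negligible_iff_null_sets null_sets_completionI)
    then have "negligible (F ` A)"
    proof (rule negligible_locally_Lipschitz_image[OF order_refl])
      fix x
      show "\<exists>T B. open T \<and> x \<in> T \<and> (\<forall>y\<in>A \<inter> T. norm (F y - F x) \<le> B * norm (y - x))"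
        using Flip by (intro exI[of _ UNIV] exI[of _ C]) auto
    qed
    moreover have "F ` A \<in> sets borel"
      using A measurable_sets_borel[of g borel A] by (simp add: vimage null_sets_def)
    ultimately have "emeasure lborel (F ` A) = 0"
      by (simp add: negligible_iff_null_sets null_sets_def)
    then show "A \<in> null_sets M"
      using A by (simp add: null_sets_def M_def emeasure_distr vimage)
  qed
  then obtain d where [measurable]: "d \<in> borel_measurable lborel" and d: "density lborel d = M"
    using sigma_finite_measure.Radon_Nikodym[OF sigma_finite_lborel, of M] unfolding M_def by auto
  have nn: "(\<integral>\<^sup>+x. d x * indicator {a..b} x \<partial>lborel) = ennreal (F b - F a)" if "a \<le> b" for a b
  proof -
    have "(\<integral>\<^sup>+x. d x * indicator {a..b} x \<partial>lborel) = emeasure M {a..b}"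
      unfolding d[symmetric] by (subst emeasure_density) auto
    also have "\<dots> = emeasure lborel (g -` {a..b})"
      by (simp add: M_def emeasure_distr)
    also have "g -` {a..b} = {F a..F b}"
      by (auto simp: mono Fg) (metis Fg mono)+
    finally show ?thesis
      using that by (simp add: mono)
  qed
  \<comment> \<open>The density is extended-real valued; finite mass on bounded intervals makes it finite almost
    everywhere, so that it can be replaced by a real function.\<close>
  have "AE x in lborel. \<forall>n::nat. d x * indicator {- real n..real n} x \<noteq> \<infinity>"
    unfolding AE_all_countable
    by (intro allI nn_integral_PInf_AE) (auto simp: nn)
  then have fin: "AE x in lborel. d x \<noteq> \<infinity>"
  proof eventually_elim
    fix x assume *: "\<forall>n::nat. d x * indicator {- real n..real n} x \<noteq> \<infinity>"
    obtain n :: nat where "\<bar>x\<bar> \<le> real n"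
      using real_arch_simple by blast
    then show "d x \<noteq> \<infinity>"
      using *[rule_format, of n] by (auto simp: indicator_def abs_le_iff split: if_splits)
  qed
  show thesis
  proof (rule that)
    fix a b :: real assume ab: "a \<le> b"
    have "(\<integral>\<^sup>+x. ennreal (enn2real (d x) * indicator {a..b} x) \<partial>lborel)
        = (\<integral>\<^sup>+x. d x * indicator {a..b} x \<partial>lborel)"
      by (rule nn_integral_cong_AE, use fin in eventually_elim)
         (auto simp: indicator_def less_top)
    then have "((\<lambda>x. enn2real (d x) * indicator {a..b} x) has_integral F b - F a) UNIV"
      using ab by (intro nn_integral_has_integral) (auto simp: nn mono)
    then have "((\<lambda>x. if x \<in> {a..b} then enn2real (d x) else 0) has_integral F b - F a) UNIV"
      by (rule has_integral_eq[rotated]) (auto simp: indicator_def)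
    then show "((\<lambda>x. enn2real (d x)) has_integral F b - F a) {a..b}"
      by (simp only: has_integral_restrict_UNIV)
  qed
qed

section \<open>An indefinite integral is differentiable almost everywhere\<close>

text \<open>
  This is Lebesgue's differentiation theorem \<open>integrable_ccontinuous_explicit\<close>, whose averages are
  taken over intervals to the right of the point and therefore control only the right derivative.
\<close>

lemma right_derivative_of_primitive:
  fixes F h :: "real \<Rightarrow> real"
  assumes h: "\<And>a b. a \<le> b \<Longrightarrow> (h has_integral F b - F a) {a..b}"
  obtains N where "negligible N"
    "\<And>x. x \<notin> N \<Longrightarrow> ((\<lambda>y. (F y - F x) / (y - x)) \<longlongrightarrow> h x) (at_right x)"
proof -
  have "h integrable_on cbox a b" for a b
    using h[of a b] by (cases "a \<le> b") (auto intro: has_integral_integrable)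
  then obtain N where N: "negligible N" and
    lim: "\<And>x e. \<lbrakk>x \<notin> N; 0 < e\<rbrakk> \<Longrightarrow> \<exists>d>0. \<forall>t. 0 < t \<and> t < d \<longrightarrow>
           norm (integral (cbox x (x + t *\<^sub>R One)) h /\<^sub>R t ^ DIM(real) - h x) < e"
    using integrable_ccontinuous_explicit[of h] by metis
  have "((\<lambda>y. (F y - F x) / (y - x)) \<longlongrightarrow> h x) (at_right x)" if x: "x \<notin> N" for x
  proof (rule tendstoI)
    fix e :: real assume "0 < e"
    then obtain d where "d > 0" and d: "\<And>t. 0 < t \<Longrightarrow> t < d \<Longrightarrow>
        norm (integral (cbox x (x + t *\<^sub>R One)) h /\<^sub>R t ^ DIM(real) - h x) < e"
      using lim[OF x] by metis
    have "dist ((F y - F x) / (y - x)) (h x) < e" if "x < y" "y < x + d" for y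
      using d[of "y - x"] that integral_unique[OF h[of x y]]
      by (simp add: dist_real_def divide_inverse_commute)
    then show "\<forall>\<^sub>F y in at_right x. dist ((F y - F x) / (y - x)) (h x) < e"
      using \<open>d > 0\<close> by (intro eventually_at_rightI[of x "x + d"]) auto
  qed
  with N show thesis
    by (rule that)
qed

text \<open>
  The left derivative of \<open>F\<close> at \<open>x\<close> is the right derivative at \<open>- x\<close> of \<open>\<lambda>y. - F (- y)\<close>, which is an
  indefinite integral of \<open>\<lambda>y. h (- y)\<close>.
\<close>

lemma derivative_of_primitive:
  fixes F h :: "real \<Rightarrow> real"
  assumes h: "\<And>a b. a \<le> b \<Longrightarrow> (h has_integral F b - F a) {a..b}"
  obtains N where "negligible N" "\<And>x. x \<notin> N \<Longrightarrow> (F has_real_derivative h x) (at x)"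
proof -
  obtain N where N: "negligible N"
    "\<And>x. x \<notin> N \<Longrightarrow> ((\<lambda>y. (F y - F x) / (y - x)) \<longlongrightarrow> h x) (at_right x)"
    using right_derivative_of_primitive[OF h] by blast
  have "((\<lambda>x. h (- x)) has_integral - F (- b) - - F (- a)) {a..b}" if "a \<le> b" for a b
    using h[of "- b" "- a"] that has_integral_reflect_real[of h "F (- a) - F (- b)" "- a" "- b"]
    by simp
  then obtain N' where N': "negligible N'"
    "\<And>x. x \<notin> N' \<Longrightarrow> ((\<lambda>y. (- F (- y) - - F (- x)) / (y - x)) \<longlongrightarrow> h (- x)) (at_right x)"
    using right_derivative_of_primitive[of "\<lambda>x. h (- x)" "\<lambda>x. - F (- x)"] by blast
  show thesis
  proof (rule that)
    have "negligible (uminus ` N')"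
    proof (rule negligible_locally_Lipschitz_image[OF order_refl N'(1)])
      fix x
      show "\<exists>T B. open T \<and> x \<in> T \<and> (\<forall>y\<in>N' \<inter> T. norm (- y - - x) \<le> B * norm (y - x))"
        by (intro exI[of _ UNIV] exI[of _ "1::real"]) auto
    qed
    then show "negligible (N \<union> uminus ` N')"
      using N(1) by (intro negligible_Un)
    fix x assume x: "x \<notin> N \<union> uminus ` N'"
    then have "- x \<notin> N'"
      by (metis UnI2 image_eqI minus_minus)
    from N'(2)[OF this]
    have "((\<lambda>y. (- F (- y) + F x) / (y + x)) \<longlongrightarrow> h x) (at_right (- x))"
      by simp
    also have "(\<lambda>y. (- F (- y) + F x) / (y + x)) = (\<lambda>y. (F (- y) - F x) / (- y - x))"
      by (intro ext) (metis add.commute diff_conv_add_uminus minus_diff_eq minus_divide_divide minus_minus)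
    finally have "((\<lambda>y. (F y - F x) / (y - x)) \<longlongrightarrow> h x) (at_left x)"
      by (simp add: filterlim_at_left_to_right)
    then show "(F has_real_derivative h x) (at x)"
      using N(2)[of x] x by (simp add: has_field_derivative_iff filterlim_split_at)
  qed
qed

section \<open>The fundamental theorem of calculus for Lipschitz curves\<close>

lemma Lipschitz_real_has_ae_derivative:
  fixes f :: "real \<Rightarrow> real"
  assumes f: "L-lipschitz_on UNIV f"
  obtains h N where "negligible N" "\<And>a b. a \<le> b \<Longrightarrow> (h has_integral f b - f a) {a..b}"
    "\<And>x. x \<notin> N \<Longrightarrow> (f has_real_derivative h x) (at x)"
proof -
  \<comment> \<open>The slopes of \<open>f\<close> lie in \<open>{- L..L}\<close>; the linear term shifts them to \<open>{1..2 * L + 1}\<close>.\<close>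
  define F where "F x = f x + (L + 1) * x" for x
  have bound: "\<bar>f y - f x\<bar> \<le> L * (y - x)" if "x \<le> y" for x y
    using lipschitz_onD[OF f, of y x] that by (simp add: dist_real_def)
  obtain h where h: "\<And>a b. a \<le> b \<Longrightarrow> (h has_integral F b - F a) {a..b}"
  proof (rule expanding_Lipschitz_has_density[of F "2 * L + 1"])
    fix x y :: real assume "x \<le> y"
    from bound[OF this] show "y - x \<le> F y - F x" "F y - F x \<le> (2 * L + 1) * (y - x)"
      by (auto simp: F_def algebra_simps abs_le_iff)
  qed blast
  obtain N where N: "negligible N" "\<And>x. x \<notin> N \<Longrightarrow> (F has_real_derivative h x) (at x)"
    using derivative_of_primitive[OF h] by blast
  show thesis
  proof (rule that[OF N(1)])
    fix a b :: real assume "a \<le> b"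
    then have "((\<lambda>x. h x - (L + 1)) has_integral (F b - F a) - (b - a) *\<^sub>R (L + 1)) {a..b}"
      using has_integral_diff[OF h has_integral_const_real[of "L + 1" a b]] by simp
    then show "((\<lambda>x. h x - (L + 1)) has_integral f b - f a) {a..b}"
      by (simp add: F_def algebra_simps)
  next
    fix x assume "x \<notin> N"
    from N(2)[OF this] have "((\<lambda>x. F x - (L + 1) * x) has_real_derivative h x - (L + 1)) (at x)"
      by (auto intro!: derivative_eq_intros)
    then show "(f has_real_derivative h x - (L + 1)) (at x)"
      by (simp add: F_def)
  qed
qed


lemma Lipschitz_has_ae_derivative:
  fixes f :: "real \<Rightarrow> 'a::euclidean_space"
  assumes f: "L-lipschitz_on UNIV f"
  obtains h N where "negligible N" "\<And>a b. a \<le> b \<Longrightarrow> (h has_integral f b - f a) {a..b}"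
    "\<And>x. x \<notin> N \<Longrightarrow> (f has_vector_derivative h x) (at x)"
proof -
  have "\<exists>h N. negligible N \<and> (\<forall>a b. a \<le> b \<longrightarrow> (h has_integral f b \<bullet> i - f a \<bullet> i) {a..b})
      \<and> (\<forall>x. x \<notin> N \<longrightarrow> ((\<lambda>x. f x \<bullet> i) has_real_derivative h x) (at x))"
    if i: "i \<in> Basis" for i
  proof -
    have "L-lipschitz_on UNIV (\<lambda>x. f x \<bullet> i)"
    proof (rule lipschitz_onI)
      fix x y
      have "\<bar>(f x - f y) \<bullet> i\<bar> \<le> norm (f x - f y)"
        using i by (rule Basis_le_norm)
      also have "\<dots> \<le> L * dist x y"
        using lipschitz_onD[OF f, of x y] by (simp add: dist_norm)
      finally show "dist (f x \<bullet> i) (f y \<bullet> i) \<le> L * dist x y"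
        by (simp add: dist_real_def inner_diff_left)
    qed (rule lipschitz_on_nonneg[OF f])
    then show ?thesis
      by (rule Lipschitz_real_has_ae_derivative) blast
  qed
  then obtain h N where
    N: "\<And>i. i \<in> Basis \<Longrightarrow> negligible (N i)" and
    h: "\<And>i a b. i \<in> Basis \<Longrightarrow> a \<le> b \<Longrightarrow> (h i has_integral f b \<bullet> i - f a \<bullet> i) {a..b}" and
    D: "\<And>i x. i \<in> Basis \<Longrightarrow> x \<notin> N i \<Longrightarrow> ((\<lambda>x. f x \<bullet> i) has_real_derivative h i x) (at x)"
    by metis
  define H where "H x = (\<Sum>i\<in>Basis. h i x *\<^sub>R i)" for x
  have H: "H x \<bullet> i = h i x" if "i \<in> Basis" for x i
    using that by (simp add: H_def)
  show thesis
  proof (rule that)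
    show "negligible (\<Union>i\<in>Basis. N i)"
      using N by (intro negligible_Union) auto
    show "(H has_integral f b - f a) {a..b}" if "a \<le> b" for a b
      by (rule has_integral_componentwise) (use h[OF _ that] in \<open>simp add: H inner_diff_left\<close>)
    show "(f has_vector_derivative H x) (at x)" if "x \<notin> (\<Union>i\<in>Basis. N i)" for x
      unfolding has_vector_derivative_def
    proof (subst has_derivative_componentwise_within, intro ballI)
      fix i :: 'a assume "i \<in> Basis"
      then show "((\<lambda>x. f x \<bullet> i) has_derivative (\<lambda>y. (y *\<^sub>R H x) \<bullet> i)) (at x)"
        using D[of i x] that by (simp add: H has_field_derivative_def mult_commute_abs)
    qed
  qed
qed

text \<open>
  The derivative is one-sided at the endpoints and is an unspecified vector at the points where
  the curve is not differentiable; these form a null set and do not affect the integrals. The proof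
  extends the curve to the whole line by constants. Absolute integrability holds because
  the derivative is integrable and bounded by the Lipschitz constant almost everywhere.
\<close>

theorem Lipschitz_fundamental_theorem:
  fixes f :: "real \<Rightarrow> 'a::euclidean_space"
  assumes f: "L-lipschitz_on {a..b} f" and "a < b"
  shows "negligible {x \<in> {a..b}. \<not> f differentiable (at x within {a..b})}" (is "negligible ?E")
    and "((\<lambda>x. vector_derivative f (at x within {a..b})) has_integral f b - f a) {a..b}"
    and "(\<lambda>x. vector_derivative f (at x within {a..b})) absolutely_integrable_on {a..b}"
proof -
  define c where "c x = max a (min b x)" for x
  have c: "c x \<in> {a..b}" "x \<in> {a..b} \<Longrightarrow> c x = x" for x
    using \<open>a < b\<close> by (auto simp: c_def)
  have "L-lipschitz_on UNIV (\<lambda>x. f (c x))"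
  proof (rule lipschitz_onI)
    fix x y
    have "dist (f (c x)) (f (c y)) \<le> L * dist (c x) (c y)"
      by (intro lipschitz_onD[OF f] c(1))
    also have "\<dots> \<le> L * dist x y"
      by (intro mult_left_mono lipschitz_on_nonneg[OF f])
         (auto simp: c_def dist_real_def max_def min_def)
    finally show "dist (f (c x)) (f (c y)) \<le> L * dist x y" .
  qed (rule lipschitz_on_nonneg[OF f])
  then obtain h N where N: "negligible N"
    and h: "\<And>x y. x \<le> y \<Longrightarrow> (h has_integral f (c y) - f (c x)) {x..y}"
    and D: "\<And>x. x \<notin> N \<Longrightarrow> ((\<lambda>x. f (c x)) has_vector_derivative h x) (at x)"
    by (rule Lipschitz_has_ae_derivative[of L "\<lambda>x. f (c x)"]) (rule that)
  have D': "(f has_vector_derivative h x) (at x within {a..b})" if "x \<in> {a..b} - N" for x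
    using that c(2) has_vector_derivative_at_within[OF D[of x]]
    by (intro has_vector_derivative_transform[of x "{a..b}" f "\<lambda>x. f (c x)"]) auto
  let ?D = "\<lambda>x. vector_derivative f (at x within {a..b})"
  have eq: "?D x = h x" if "x \<in> {a..b} - N" for x
    using that D' \<open>a < b\<close> by (intro vector_derivative_within_closed_interval) auto
  show "negligible ?E"
    by (rule negligible_subset[OF N]) (use D' in \<open>auto intro: differentiableI_vector\<close>)
  show int: "(?D has_integral f b - f a) {a..b}"
    using h[of a b] c(2) \<open>a < b\<close> by (intro has_integral_spike[OF N eq]) auto
  have "norm (?D x) \<le> L" if "x \<in> {a..b} - N" for x
  proof -
    define q where "q y = norm ((f y - f x) - (y - x) *\<^sub>R h x) / norm (y - x)" for y
    have lim: "(q \<longlongrightarrow> 0) (at x within {a..b})"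
      using D'[OF that] unfolding q_def
      by (simp add: has_vector_derivative_def has_derivative_iff_norm)
    have "norm (h x) - L \<le> q y" if y: "y \<in> {a..b}" "y \<noteq> x" for y
    proof -
      have "norm ((y - x) *\<^sub>R h x) - norm (f y - f x) \<le> norm ((f y - f x) - (y - x) *\<^sub>R h x)"
        by (metis norm_minus_commute norm_triangle_ineq2)
      moreover have "norm (f y - f x) \<le> L * norm (y - x)"
        using lipschitz_onD[OF f, of y x] y \<open>x \<in> {a..b} - N\<close> by (simp add: dist_norm)
      ultimately have "(norm (h x) - L) * norm (y - x) \<le> norm ((f y - f x) - (y - x) *\<^sub>R h x)"
        by (simp add: left_diff_distrib mult.commute[of "norm (h x)"])
      then show ?thesis
        using y(2) by (simp add: q_def pos_le_divide_eq)
    qed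
    then have "\<forall>\<^sub>F y in at x within {a..b}. norm (h x) - L \<le> q y"
      by (simp add: eventually_at_filter)
    then have "norm (h x) - L \<le> 0"
      using that \<open>a < b\<close> by (intro tendsto_lowerbound[OF lim])
        (auto simp: trivial_limit_within islimpt_Icc)
    then show ?thesis
      using eq that by simp
  qed
  \<comment> \<open>The bound may fail on \<open>N\<close>, where the derivative takes unspecified values, so it is changed
    to zero there.\<close>
  then have bound: "norm (if x \<in> N then 0 else ?D x) \<le> L" if "x \<in> {a..b}" for x
    using that lipschitz_on_nonneg[OF f] by auto
  have "(\<lambda>x. if x \<in> N then 0 else ?D x) integrable_on {a..b}"
    by (rule integrable_spike[OF has_integral_integrable[OF int] N]) auto
  then have "(\<lambda>x. if x \<in> N then 0 else ?D x) absolutely_integrable_on {a..b}"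
    by (intro absolutely_integrable_integrable_bound[OF bound]) auto
  then show "?D absolutely_integrable_on {a..b}"
    by (rule absolutely_integrable_spike[OF _ N]) auto
qed

section \<open>The Rankine-Hugoniot condition\<close>

text \<open>
  A single curve of the family has a global Lipschitz constant by compactness of \<open>{0..1}\<close>. The
  theorem on \<open>local_lipschitz\<close> concerns families of functions; the one-point parameter set
  \<open>{0}\<close> turns it into a theorem about one function.
\<close>

lemma DLM_path_Lipschitz:
  assumes "DLM_path \<phi>"
  obtains L where "L-lipschitz_on {0..1} (\<lambda>t. \<phi> t vL vR)"
proof -
  have "local_lipschitz {0 :: real} {0..1} (\<lambda>_ t. \<phi> t vL vR)"
    unfolding local_lipschitz_def
  proof (intro ballI)
    fix t :: real assume "t \<in> {0..1}"
    then have "(t, vL, vR) \<in> {0..1} \<times> UNIV \<times> UNIV"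
      by simp
    moreover have "locally_lipschitz_on ({0..1} \<times> UNIV \<times> UNIV) (\<lambda>(t, vL, vR). \<phi> t vL vR)"
      using assms by (simp add: DLM_path_def)
    ultimately obtain r L where "r > 0" and
      L: "L-lipschitz_on (ball (t, vL, vR) r \<inter> ({0..1} \<times> UNIV \<times> UNIV)) (\<lambda>(t, vL, vR). \<phi> t vL vR)"
      by (metis locally_lipschitz_on_def)
    have "L-lipschitz_on (cball t (r / 2) \<inter> {0..1}) (\<lambda>t. \<phi> t vL vR)"
    proof (rule lipschitz_onI)
      fix x y assume "x \<in> cball t (r / 2) \<inter> {0..1}" "y \<in> cball t (r / 2) \<inter> {0..1}"
      then show "dist (\<phi> x vL vR) (\<phi> y vL vR) \<le> L * dist x y"
        using lipschitz_onD[OF L, of "(x, vL, vR)" "(y, vL, vR)"] \<open>r > 0\<close>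
        by (auto simp: dist_Pair_Pair)
    qed (rule lipschitz_on_nonneg[OF L])
    then show "\<exists>u>0. \<exists>L. \<forall>s\<in>cball z u \<inter> {0 :: real}. L-lipschitz_on (cball t u \<inter> {0..1}) (\<lambda>t. \<phi> t vL vR)" for z
      using \<open>r > 0\<close> by (intro exI[of _ "r / 2"]) auto
  qed
  then show thesis
    using local_lipschitz_compact_implies_lipschitz[of "{0 :: real}" "{0..1}" "\<lambda>_ t. \<phi> t vL vR"] that
    by auto
qed

theorem theorem2p3:
  fixes k uL \<sigma>L uR \<sigma>R s :: real
    and vL vR :: "real^2"
    and \<phi> :: "real \<Rightarrow> real^2 \<Rightarrow> real^2 \<Rightarrow> real^2"
  assumes "k > 0"
    and "vL = vector [uL, \<sigma>L]" and "vR = vector [uR, \<sigma>R]"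
    and "uL \<noteq> uR"
    and "DLM_path \<phi>"
    and "s = ((uR\<^sup>2 / 2 - uL\<^sup>2 / 2) - (\<sigma>R - \<sigma>L)) / (uR - uL)"
    and "integral {0..1} (\<lambda>t. \<phi> t vL vR $ 1 * t_deriv (\<lambda>t. \<phi> t vL vR $ 2) t)
           = (\<sigma>R - \<sigma>L) * (((uR\<^sup>2 / 2 - uL\<^sup>2 / 2) - (\<sigma>R - \<sigma>L)) / (uR - uL)) + k\<^sup>2 * (uR - uL)"
  shows "rankine_hugoniot (coeff_matrix k) \<phi> s vL vR"
proof -
  define p where "p t = \<phi> t vL vR" for t
  obtain L where L: "L-lipschitz_on {0..1} p"
    using DLM_path_Lipschitz[OF \<open>DLM_path \<phi>\<close>] unfolding p_def by blast
  have ends: "p 0 = vL" "p 1 = vR"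
    using \<open>DLM_path \<phi>\<close> by (auto simp: DLM_path_def p_def)
  define u where "u = (\<lambda>t. p t $ 1)"
  define \<sigma> where "\<sigma> = (\<lambda>t. p t $ 2)"
  have ends_component: "u 0 = uL" "u 1 = uR" "\<sigma> 0 = \<sigma>L" "\<sigma> 1 = \<sigma>R"
    using assms(2,3) by (simp_all add: u_def \<sigma>_def ends)
  have lip_component: "L-lipschitz_on {0..1} (\<lambda>t. p t $ i)" for i
  proof (rule lipschitz_onI)
    fix x y :: real assume "x \<in> {0..1}" "y \<in> {0..1}"
    then show "dist (p x $ i) (p y $ i) \<le> L * dist x y"
      using lipschitz_onD[OF L] dist_vec_nth_le order_trans by blast
  qed (rule lipschitz_on_nonneg[OF L])
  have lip_u: "L-lipschitz_on {0..1} u" and lip_\<sigma>: "L-lipschitz_on {0..1} \<sigma>"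
    using lip_component unfolding u_def \<sigma>_def by auto
  have cont_u: "continuous_on {0..1} u"
    using lip_u by (rule lipschitz_on_continuous_on)
  then have "bounded (u ` {0..1})"
    by (intro compact_imp_bounded compact_continuous_image) auto
  then obtain B where "B > 0" and B: "\<And>t. t \<in> {0..1} \<Longrightarrow> \<bar>u t\<bar> \<le> B"
    unfolding bounded_pos by auto
  \<comment> \<open>Squaring preserves the Lipschitz property because \<open>u\<close> is bounded on \<open>{0..1}\<close>.\<close>
  have lip_sq: "(B * L)-lipschitz_on {0..1} (\<lambda>t. (u t)\<^sup>2 / 2)"
  proof (rule lipschitz_onI)
    fix x y :: real assume xy: "x \<in> {0..1}" "y \<in> {0..1}"
    have "dist ((u x)\<^sup>2 / 2) ((u y)\<^sup>2 / 2) = \<bar>(u x + u y) / 2\<bar> * dist (u x) (u y)"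
      by (simp add: dist_real_def abs_mult[symmetric] power2_eq_square field_simps)
    also have "\<dots> \<le> B * (L * dist x y)"
      using B[OF xy(1)] B[OF xy(2)] lipschitz_onD[OF lip_u xy] \<open>B > 0\<close>
      by (intro mult_mono) auto
    finally show "dist ((u x)\<^sup>2 / 2) ((u y)\<^sup>2 / 2) \<le> B * L * dist x y"
      by (simp add: mult.assoc)
  qed (use \<open>B > 0\<close> lipschitz_on_nonneg[OF L] in simp)
  \<comment> \<open>Off \<open>N\<close> the derivatives of \<open>u\<close>, \<open>\<sigma>\<close> and \<open>u\<^sup>2 / 2\<close> are expressed by the components of \<open>p'\<close>; on
    \<open>N\<close> the unspecified derivative of \<open>p\<close> need not agree with those of its components.\<close>
  define N where "N = {t \<in> {0..1}. \<not> p differentiable (at t within {0..1})}"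
  have N: "negligible N"
    unfolding N_def using Lipschitz_fundamental_theorem(1)[OF L] by simp
  define p' where "p' = t_deriv p"
  have p': "(p has_vector_derivative p' t) (at t within {0..1})" if "t \<in> {0..1} - N" for t
    using that unfolding N_def p'_def t_deriv_def by (simp add: vector_derivative_works)
  have u': "(u has_vector_derivative p' t $ 1) (at t within {0..1})"
    and \<sigma>': "(\<sigma> has_vector_derivative p' t $ 2) (at t within {0..1})" if "t \<in> {0..1} - N" for t
    unfolding u_def \<sigma>_def
    using bounded_linear.has_vector_derivative[OF bounded_linear_vec_nth p'[OF that]] by auto
  note deriv_eq = vector_derivative_within_closed_interval[OF zero_less_one]

  have u'_int: "((\<lambda>t. p' t $ 1) has_integral uR - uL) {0..1}"
    using Lipschitz_fundamental_theorem(2)[OF lip_u zero_less_one]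
    unfolding ends_component
    by (rule has_integral_spike[OF N, rotated])
       (use u' in \<open>auto intro!: deriv_eq[symmetric]\<close>)
  have \<sigma>'_int: "((\<lambda>t. p' t $ 2) has_integral \<sigma>R - \<sigma>L) {0..1}"
    using Lipschitz_fundamental_theorem(2)[OF lip_\<sigma> zero_less_one]
    unfolding ends_component
    by (rule has_integral_spike[OF N, rotated])
       (use \<sigma>' in \<open>auto intro!: deriv_eq[symmetric]\<close>)
  have uu'_int: "((\<lambda>t. u t * p' t $ 1) has_integral uR\<^sup>2 / 2 - uL\<^sup>2 / 2) {0..1}"
    using Lipschitz_fundamental_theorem(2)[OF lip_sq zero_less_one]
    unfolding ends_component
  proof (rule has_integral_spike[OF N, rotated])
    fix t assume t: "t \<in> {0..1} - N"
    have "(u has_real_derivative p' t $ 1) (at t within {0..1})"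
      using u'[OF t]
      by (simp add: has_real_derivative_iff_has_vector_derivative)
    then have "((\<lambda>t. (u t)\<^sup>2 / 2) has_real_derivative u t * p' t $ 1) (at t within {0..1})"
      by (auto intro!: derivative_eq_intros)
    then show "u t * p' t $ 1 = vector_derivative (\<lambda>t. (u t)\<^sup>2 / 2) (at t within {0..1})"
      using t by (intro deriv_eq[symmetric])
        (auto simp: has_real_derivative_iff_has_vector_derivative)
  qed
  have "(\<lambda>t. u t * t_deriv \<sigma> t) absolutely_integrable_on {0..1}"
    using Lipschitz_fundamental_theorem(3)[OF lip_\<sigma> zero_less_one] cont_u \<open>bounded (u ` {0..1})\<close>
    unfolding t_deriv_def
    by (intro absolutely_integrable_bounded_measurable_product_real
          continuous_imp_measurable_on_sets_lebesgue) auto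
  then have "((\<lambda>t. u t * t_deriv \<sigma> t) has_integral integral {0..1} (\<lambda>t. u t * t_deriv \<sigma> t)) {0..1}"
    by (intro integrable_integral set_lebesgue_integral_eq_integral(1))
  also have "integral {0..1} (\<lambda>t. u t * t_deriv \<sigma> t) = (\<sigma>R - \<sigma>L) * s + k\<^sup>2 * (uR - uL)"
    using assms(6,7) by (simp add: u_def \<sigma>_def p_def[symmetric])
  finally have u\<sigma>'_int:
    "((\<lambda>t. u t * p' t $ 2) has_integral (\<sigma>R - \<sigma>L) * s + k\<^sup>2 * (uR - uL)) {0..1}"
    by (rule has_integral_spike[OF N, rotated])
       (use \<sigma>' in \<open>auto simp: t_deriv_def intro!: deriv_eq[symmetric]\<close>)

  let ?G = "\<lambda>t. (- (s *\<^sub>R mat 1) + coeff_matrix k (p t)) *v p' t"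
  have G1: "?G t $ 1 = u t * p' t $ 1 - s * p' t $ 1 - p' t $ 2"
    and G2: "?G t $ 2 = u t * p' t $ 2 - s * p' t $ 2 - k\<^sup>2 * p' t $ 1" for t
    by (simp_all add: matrix_vector_mult_def sum_2 coeff_matrix_def mat_def u_def algebra_simps)
  have "((\<lambda>t. ?G t $ 1) has_integral (uR\<^sup>2 / 2 - uL\<^sup>2 / 2) - s * (uR - uL) - (\<sigma>R - \<sigma>L)) {0..1}"
    unfolding G1 by (intro has_integral_diff has_integral_mult_right uu'_int u'_int \<sigma>'_int)
  moreover have "(uR\<^sup>2 / 2 - uL\<^sup>2 / 2) - s * (uR - uL) - (\<sigma>R - \<sigma>L) = 0"
    using \<open>uL \<noteq> uR\<close> by (simp add: assms(6))
  ultimately have int1: "((\<lambda>t. ?G t $ 1) has_integral 0) {0..1}"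
    by simp
  have "((\<lambda>t. ?G t $ 2) has_integral
      (\<sigma>R - \<sigma>L) * s + k\<^sup>2 * (uR - uL) - s * (\<sigma>R - \<sigma>L) - k\<^sup>2 * (uR - uL)) {0..1}"
    unfolding G2 by (intro has_integral_diff has_integral_mult_right u\<sigma>'_int u'_int \<sigma>'_int)
  then have int2: "((\<lambda>t. ?G t $ 2) has_integral 0) {0..1}"
    by (simp add: mult.commute)
  have "(?G has_integral 0) {0..1}"
  proof (rule has_integral_componentwise)
    fix b :: "real^2" assume "b \<in> Basis"
    then obtain i where "b = axis i 1"
      by (auto simp: Basis_vec_def)
    then show "((\<lambda>t. ?G t \<bullet> b) has_integral 0 \<bullet> b) {0..1}"
      using int1 int2 exhaust_2[of i] by (auto simp: inner_axis)
  qed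
  then show ?thesis
    unfolding rankine_hugoniot_def p'_def p_def .
qed

end
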